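(* Let $X,Y$ be topological spaces and let $\phi:X\to Y$ be a continuous and strongly $H^*$-closed surjection, where $X$ is $H^*$-normal. Then $Y$ is $H^*$-normal.
   Context: No separation axioms are assumed. Let $X$ be a topological space and $A\subseteq X$. $A$ is semi-closed if $\operatorname{int}(\operatorname{cl}(A))\subseteq A$, and semi-open if its complement is semi-closed; $s\text{-}\operatorname{cl}(A)$ is the intersection of all semi-closed sets containing $A$. $A$ is $w$-closed if $\operatorname{cl}(A)\subseteq U$ whenever $A\subseteq U$ and $U$ is semi-open; $w$-open means complement of $w$-closed. $A$ is $h$-closed if $s\text{-}\operatorname{cl}(A)\subseteq U$ whenever $A\subseteq U$ and $U$ is $w$-open; $h\text{-}\operatorname{cl}(A)$ is the intersection of all $h$-closed sets containing $A$. A set $V$ is an $\alpha^*$-set if $\operatorname{int}(\operatorname{cl}(\operatorname{int}(V)))=\operatorname{int}(V)$; a $C$-set is a set of the form $U\cap V$ with $U$ open and $V$ an $\alpha^*$-set. $A$ is $hCg$-closed if $h\text{-}\operatorname{cl}(A)\subseteq U$ whenever $A\subseteq U$ and $U$ is a $C$-set; $hCg$-open means complement of $hCg$-closed. $A$ is $H^*$-closed if $h\text{-}\operatorname{cl}(A)\subseteq U$ whenever $A\subseteq U$ and $U$ is $hCg$-open; $H^*$-open means complement of $H^*$-closed. $X$ is $H^*$-normal if for any pair of disjoint closed sets $A,B\subseteq X$ there exist disjoint $H^*$-open sets $U,V$ with $A\subseteq U$ and $B\subseteq V$. A function $\phi:X\to Y$ is strongly $H^*$-closed if $\phi(U)$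 is $H^*$-closed in $Y$ for each $H^*$-closed $U\subseteq X$. *)

theory Defs
  imports "HOL-Analysis.Abstract_Topology"
begin

text \<open>All notions are relative to a topology X on a carrier \<open>topspace X\<close>. As in the library's
  \<^const>\<open>closedin\<close>, each predicate on a set includes the requirement that the set is contained in
  the carrier, and complements are taken in the carrier.\<close>

definition semi_closedin :: "'a topology \<Rightarrow> 'a set \<Rightarrow> bool" where
  "semi_closedin X A \<longleftrightarrow> A \<subseteq> topspace X \<and> X interior_of (X closure_of A) \<subseteq> A"

definition semi_openin :: "'a topology \<Rightarrow> 'a set \<Rightarrow> bool" where
  "semi_openin X A \<longleftrightarrow> A \<subseteq> topspace X \<and> semi_closedin X (topspace X - A)"

text \<open>In the two closure operators below, for \<open>A \<subseteq> topspace X\<close> the family of sets is nonempty,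
  since it contains \<open>topspace X\<close>; they are only applied to such sets.\<close>

definition semi_closure_of :: "'a topology \<Rightarrow> 'a set \<Rightarrow> 'a set" where
  "semi_closure_of X A = \<Inter>{F. semi_closedin X F \<and> A \<subseteq> F}"

definition w_closedin :: "'a topology \<Rightarrow> 'a set \<Rightarrow> bool" where
  "w_closedin X A \<longleftrightarrow> A \<subseteq> topspace X \<and>
     (\<forall>U. semi_openin X U \<and> A \<subseteq> U \<longrightarrow> X closure_of A \<subseteq> U)"

definition w_openin :: "'a topology \<Rightarrow> 'a set \<Rightarrow> bool" where
  "w_openin X A \<longleftrightarrow> A \<subseteq> topspace X \<and> w_closedin X (topspace X - A)"

definition h_closedin :: "'a topology \<Rightarrow> 'a set \<Rightarrow> bool" where
  "h_closedin X A \<longleftrightarrow> A \<subseteq> topspace X \<and>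
     (\<forall>U. w_openin X U \<and> A \<subseteq> U \<longrightarrow> semi_closure_of X A \<subseteq> U)"

definition h_closure_of :: "'a topology \<Rightarrow> 'a set \<Rightarrow> 'a set" where
  "h_closure_of X A = \<Inter>{F. h_closedin X F \<and> A \<subseteq> F}"

definition alpha_star_set :: "'a topology \<Rightarrow> 'a set \<Rightarrow> bool" where
  "alpha_star_set X V \<longleftrightarrow> V \<subseteq> topspace X \<and>
     X interior_of (X closure_of (X interior_of V)) = X interior_of V"

definition C_set :: "'a topology \<Rightarrow> 'a set \<Rightarrow> bool" where
  "C_set X A \<longleftrightarrow> (\<exists>U V. openin X U \<and> alpha_star_set X V \<and> A = U \<inter> V)"

definition hCg_closedin :: "'a topology \<Rightarrow> 'a set \<Rightarrow> bool" where
  "hCg_closedin X A \<longleftrightarrow> A \<subseteq> topspace X \<and>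
     (\<forall>U. C_set X U \<and> A \<subseteq> U \<longrightarrow> h_closure_of X A \<subseteq> U)"

definition hCg_openin :: "'a topology \<Rightarrow> 'a set \<Rightarrow> bool" where
  "hCg_openin X A \<longleftrightarrow> A \<subseteq> topspace X \<and> hCg_closedin X (topspace X - A)"

definition Hstar_closedin :: "'a topology \<Rightarrow> 'a set \<Rightarrow> bool" where
  "Hstar_closedin X A \<longleftrightarrow> A \<subseteq> topspace X \<and>
     (\<forall>U. hCg_openin X U \<and> A \<subseteq> U \<longrightarrow> h_closure_of X A \<subseteq> U)"

definition Hstar_openin :: "'a topology \<Rightarrow> 'a set \<Rightarrow> bool" where
  "Hstar_openin X A \<longleftrightarrow> A \<subseteq> topspace X \<and> Hstar_closedin X (topspace X - A)"

definition Hstar_normal_space :: "'a topology \<Rightarrow> bool" where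
  "Hstar_normal_space X \<longleftrightarrow>
     (\<forall>A B. closedin X A \<and> closedin X B \<and> disjnt A B \<longrightarrow>
        (\<exists>U V. Hstar_openin X U \<and> Hstar_openin X V \<and> A \<subseteq> U \<and> B \<subseteq> V \<and> disjnt U V))"

definition strongly_Hstar_closed_map :: "'a topology \<Rightarrow> 'b topology \<Rightarrow> ('a \<Rightarrow> 'b) \<Rightarrow> bool" where
  "strongly_Hstar_closed_map X Y f \<longleftrightarrow> (\<forall>U. Hstar_closedin X U \<longrightarrow> Hstar_closedin Y (f ` U))"

end

theory Submission
  imports Defs
begin

text \<open>Pull the two disjoint closed sets back along the continuous map, separate the preimages
  in \<open>X\<close>, and push the separating sets \<open>U\<close>, \<open>V\<close> forward by
  complement-image-complement. The result consists of the points whose whole fibre lies in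
  \<open>U\<close> (resp. \<open>V\<close>). By \<open>Hstar_openin_Diff_image\<close> these sets
  are again \<open>Hstar_openin\<close>, and surjectivity keeps them disjoint.\<close>

lemma Hstar_openin_Diff_image:
  assumes "strongly_Hstar_closed_map X Y f" and "Hstar_openin X U"
  shows "Hstar_openin Y (topspace Y - f ` (topspace X - U))"
proof -
  have closed: "Hstar_closedin Y (f ` (topspace X - U))"
    using assms by (simp add: strongly_Hstar_closed_map_def Hstar_openin_def)
  \<comment> \<open>This inclusion makes the double complement in \<open>topspace Y\<close> collapse
    to the image itself.\<close>
  then have "f ` (topspace X - U) \<subseteq> topspace Y"
    by (simp add: Hstar_closedin_def)
  with closed show ?thesis
    by (simp add: Hstar_openin_def double_diff)
qed

theorem theorem2p6:
  fixes X :: "'a topology" and Y :: "'b topology" and \<phi> :: "'a \<Rightarrow> 'b"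
  assumes "continuous_map X Y \<phi>"
    and "strongly_Hstar_closed_map X Y \<phi>"
    and "\<phi> ` topspace X = topspace Y"
    and "Hstar_normal_space X"
  shows "Hstar_normal_space Y"
  unfolding Hstar_normal_space_def
proof (intro allI impI, elim conjE)
  fix A B
  assume A: "closedin Y A" and B: "closedin Y B" and "disjnt A B"
  let ?pre = "\<lambda>S. {x \<in> topspace X. \<phi> x \<in> S}"
  let ?push = "\<lambda>W. topspace Y - \<phi> ` (topspace X - W)"
  have "closedin X (?pre A)" "closedin X (?pre B)"
    using assms(1) A B by (auto intro: closedin_continuous_map_preimage)
  moreover have "disjnt (?pre A) (?pre B)"
    using \<open>disjnt A B\<close> by (auto simp: disjnt_iff)
  ultimately obtain U V where U: "Hstar_openin X U" "?pre A \<subseteq> U"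
    and V: "Hstar_openin X V" "?pre B \<subseteq> V" and "disjnt U V"
    using assms(4) unfolding Hstar_normal_space_def by meson
  have "Hstar_openin Y (?push U)" "Hstar_openin Y (?push V)"
    using U(1) V(1) assms(2) by (simp_all add: Hstar_openin_Diff_image)
  \<comment> \<open>The fibre over a point of \<open>A\<close> lies in \<open>?pre A\<close>, hence
    in \<open>U\<close>, so no point outside \<open>U\<close> maps to it; likewise for
    \<open>B\<close>.\<close>
  moreover have "A \<subseteq> ?push U" "B \<subseteq> ?push V"
    using closedin_subset[OF A] closedin_subset[OF B] U(2) V(2) by auto
  \<comment> \<open>By surjectivity a common point would have a preimage, which would lie in both
    \<open>U\<close> and \<open>V\<close>. The reversed equation writes each point of
    \<open>topspace Y\<close> as an image.\<close>
  moreover have "disjnt (?push U) (?push V)"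
    using assms(3)[symmetric] \<open>disjnt U V\<close> by (auto simp: disjnt_iff)
  ultimately show "\<exists>U V. Hstar_openin Y U \<and> Hstar_openin Y V \<and> A \<subseteq> U \<and> B \<subseteq> V \<and> disjnt U V"
    by blast
qed

end
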